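(* Let $\alpha_1,\alpha_2,\alpha_3\in(0,1]$, $A\in\mathbb{R}^{3\times 3}$, and suppose that the characteristic function $Q(s)=\det(\operatorname{diag}(s^{\alpha_1},s^{\alpha_2},s^{\alpha_3})-A)$ has the form $$Q(s)=s^{\beta_4}-a s^{\beta_3}-b s^{\beta_2}-c s^{\beta_1}-d$$ with $0<\beta_1\le\beta_2\le\beta_3<\beta_4$, where $\beta_4=\alpha_1+\alpha_2+\alpha_3$, $a,b,c\in\mathbb{R}$ and $d=\det A$. If $a=b=0$, $c>0$, $\beta_4<2$ and $$d<-c\,\rho_1\,(c\,\tilde\rho_1)^{\beta_1/(\beta_4-\beta_1)},$$ then all zeros of $Q$ are in the open left half of $\mathbb{C}$.
   Context: Complex powers are taken with the principal branch: $s^\beta=|s|^\beta e^{\mathrm{i}\beta\arg s}$ with $\arg s\in(-\pi,\pi]$ for $s\neq 0$, and $0^\beta=0$ for $\beta>0$. Notation: $$\rho_1=\frac{\sin\frac{(\beta_4-\beta_1)\pi}{2}}{\sin\frac{\beta_4\pi}{2}},\qquad \tilde\rho_1=\frac{\sin\frac{\beta_1\pi}{2}}{\sin\frac{\beta_4\pi}{2}}.$$ *)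

theory Defs
  imports "HOL-Analysis.Analysis"
begin

definition diag_matrix :: "'a::zero ^ 'n \<Rightarrow> 'a ^ 'n ^ 'n" where
  "diag_matrix v = (\<chi> i j. if i = j then v $ i else 0)"

text \<open>
  On complex numbers, \<open>z powr w\<close> is \<open>exp (w * Ln z)\<close> for \<open>z \<noteq> 0\<close>, where \<open>Ln\<close> is the principal
  branch with imaginary part in \<open>(-pi, pi]\<close>, and \<open>0 powr w = 0\<close>. For a real exponent this is
  the principal power, including the convention at \<open>0\<close>.
\<close>

definition char_fun :: "real ^ 3 \<Rightarrow> real ^ 3 ^ 3 \<Rightarrow> complex \<Rightarrow> complex" where
  "char_fun \<alpha> A s =
     det (diag_matrix (\<chi> i. s powr complex_of_real (\<alpha> $ i)) - map_matrix complex_of_real A)"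

definition rho1 :: "real \<Rightarrow> real \<Rightarrow> real" where
  "rho1 \<beta>1 \<beta>4 = sin ((\<beta>4 - \<beta>1) * pi / 2) / sin (\<beta>4 * pi / 2)"

definition rho1_tilde :: "real \<Rightarrow> real \<Rightarrow> real" where
  "rho1_tilde \<beta>1 \<beta>4 = sin (\<beta>1 * pi / 2) / sin (\<beta>4 * pi / 2)"

end

theory Submission
  imports Defs
begin

text \<open>
  Let \<open>p = \<beta>4\<close>, \<open>q = \<beta>1\<close>. At a nonzero zero \<open>s\<close> of \<open>s^p - c s^q - d\<close> with \<open>x = \<bar>Arg s\<bar>\<close> in \<open>(0, pi/2]\<close>,
  the imaginary part determines \<open>\<bar>s\<bar>\<close>, and the real part then gives
  \<open>-d = c (sin ((p-q)x) / sin (px)) (c sin (qx) / sin (px))^(q/(p-q))\<close>. Both sine ratios increase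
  in \<open>x\<close>, so \<open>-d\<close> is at most the value at \<open>x = pi/2\<close>, which is the threshold. For \<open>x = 0\<close>, Young's
  inequality bounds \<open>-d\<close> by the limit of this expression as \<open>x\<close> tends to \<open>0\<close>.
\<close>

text \<open>Concavity of sine on [0, pi] together with sin 0 = 0. Here it follows because cosine
  decreases on [0, pi], so the difference of the two sides has nonnegative derivative.\<close>

lemma sin_scale_ge:
  fixes t x :: real
  assumes "0 \<le> t" "t \<le> 1" "0 \<le> x" "x \<le> pi"
  shows "t * sin x \<le> sin (t * x)"
proof -
  define h where "h = (\<lambda>y. sin (t * y) - t * sin y)"
  have "h 0 \<le> h x"
  proof (rule DERIV_nonneg_imp_nondecreasing[OF \<open>0 \<le> x\<close>])
    fix y assume y: "0 \<le> y" "y \<le> x"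
    have "t * y \<le> y" using assms y mult_right_mono[of t 1 y] by simp
    hence "cos y \<le> cos (t * y)" using assms y by (intro cos_monotone_0_pi_le) auto
    moreover have "(h has_real_derivative t * (cos (t * y) - cos y)) (at y)"
      unfolding h_def by (auto intro!: derivative_eq_intros simp: algebra_simps)
    ultimately show "\<exists>D. (h has_real_derivative D) (at y) \<and> 0 \<le> D"
      using assms by (intro exI[of _ "t * (cos (t * y) - cos y)"]) auto
  qed
  thus ?thesis by (simp add: h_def)
qed

text \<open>\<open>u / v\<close> is the limit of the ratio as \<open>x\<close> tends to 0; this lets
  the case of a positive real zero be compared with the threshold. It is concavity of sine with
  factor \<open>u / v\<close> at the point \<open>v * x\<close>.\<close>

lemma sin_ratio_ge:
  fixes u v x :: real
  assumes "0 < u" "u < v" "0 < x" "v * x < pi"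
  shows "u / v \<le> sin (u * x) / sin (v * x)"
proof -
  have "0 < sin (v * x)" using assms by (intro sin_gt_zero) auto
  moreover have "u / v * sin (v * x) \<le> sin (u / v * (v * x))"
    using assms by (intro sin_scale_ge) auto
  ultimately show ?thesis using assms by (simp add: pos_le_divide_eq)
qed

text \<open>This is the numerator of the derivative of sin(ux)/sin(vx). It vanishes at 0, and in its
  own derivative the cosine products cancel, leaving (v^2 - u^2) sin(ux) sin(vx).\<close>

lemma sin_wronskian_nonneg:
  fixes u v x :: real
  assumes "0 < u" "u < v" "0 \<le> x" "v * x < pi"
  shows "0 \<le> u * cos (u * x) * sin (v * x) - v * sin (u * x) * cos (v * x)"
proof -
  define h where "h = (\<lambda>y. u * cos (u * y) * sin (v * y) - v * sin (u * y) * cos (v * y))"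
  have "h 0 \<le> h x"
  proof (rule DERIV_nonneg_imp_nondecreasing[OF \<open>0 \<le> x\<close>])
    fix y assume y: "0 \<le> y" "y \<le> x"
    have "v * y \<le> v * x" "u * y \<le> v * y" "0 \<le> u * y" using assms y by (auto intro: mult_right_mono)
    moreover from this have "v * y \<le> pi" "u * y \<le> pi" using assms by linarith+
    ultimately have "0 \<le> sin (u * y)" "0 \<le> sin (v * y)" by (auto intro!: sin_ge_zero)
    moreover have "0 \<le> v * v - u * u" using assms by (simp add: mult_mono)
    moreover have "(h has_real_derivative (v * v - u * u) * (sin (u * y) * sin (v * y))) (at y)"
      unfolding h_def by (auto intro!: derivative_eq_intros simp: algebra_simps)
    ultimately show "\<exists>D. (h has_real_derivative D) (at y) \<and> 0 \<le> D"
      by (intro exI[of _ "(v * v - u * u) * (sin (u * y) * sin (v * y))"]) auto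
  qed
  thus ?thesis by (simp add: h_def)
qed

lemma sin_ratio_mono:
  fixes u v x y :: real
  assumes "0 < u" "u < v" "0 < x" "x \<le> y" "v * y < pi"
  shows "sin (u * x) / sin (v * x) \<le> sin (u * y) / sin (v * y)"
proof (rule DERIV_nonneg_imp_nondecreasing[OF \<open>x \<le> y\<close>])
  fix z assume z: "x \<le> z" "z \<le> y"
  have "v * z \<le> v * y" using assms z by simp
  hence lt: "v * z < pi" using assms by linarith
  have pos: "0 < sin (v * z)" using assms z lt by (intro sin_gt_zero) auto
  have "((\<lambda>z. sin (u * z) / sin (v * z)) has_real_derivative
      (u * cos (u * z) * sin (v * z) - v * sin (u * z) * cos (v * z)) / (sin (v * z) * sin (v * z))) (at z)"
    using pos by (auto intro!: derivative_eq_intros simp: algebra_simps)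
  moreover have "0 \<le> (u * cos (u * z) * sin (v * z) - v * sin (u * z) * cos (v * z)) / (sin (v * z) * sin (v * z))"
    using sin_wronskian_nonneg[of u v z] assms z lt by (intro divide_nonneg_nonneg) auto
  ultimately show "\<exists>D. ((\<lambda>z. sin (u * z) / sin (v * z)) has_real_derivative D) (at z) \<and> 0 \<le> D"
    by blast
qed

lemma powr_trinomial_lower_bound:
  fixes p q c r :: real
  assumes "0 < q" "q < p" "0 < c" "0 < r"
  shows "c * r powr q - r powr p \<le> c * ((p - q) / p) * (c * (q / p)) powr (q / (p - q))"
proof -
  \<comment> \<open>\<open>t\<close> is the positive critical point of c r^q - r^p as a function of
    r, so the claimed bound is the maximum of that function.\<close>
  define t where "t = (c * (q / p)) powr (1 / (p - q))"
  have t: "0 < t" using assms by (simp add: t_def)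
  have tq: "t powr q = (c * (q / p)) powr (q / (p - q))"
    and tpq: "t powr (p - q) = c * (q / p)"
    using assms by (simp_all add: t_def powr_powr)
  \<comment> \<open>The weights \<open>q / p\<close> and \<open>(p - q) / p\<close> turn the left
    side into r^q t^(p-q), which is r^q times the constant \<open>c * (q / p)\<close>; the common
    factor \<open>q / p\<close> cancels at the end.\<close>
  have young: "(r powr p) powr (q / p) * (t powr p) powr ((p - q) / p)
      \<le> q / p * r powr p + (p - q) / p * t powr p"
    using assms t by (intro Youngs_inequality_0) (auto simp: field_simps)
  have "(r powr p) powr (q / p) = r powr q" "(t powr p) powr ((p - q) / p) = t powr (p - q)"
    using assms by (simp_all add: powr_powr)
  moreover have "t powr p = t powr (p - q) * t powr q" by (simp flip: powr_add)
  ultimately have "r powr q * (c * (q / p))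
      \<le> q / p * r powr p + (p - q) / p * (c * (q / p) * t powr q)"
    using young tpq by simp
  moreover have "r powr q * (c * (q / p)) = (q / p) * (c * r powr q)"
    and "q / p * r powr p + (p - q) / p * (c * (q / p) * t powr q)
      = (q / p) * (r powr p + c * ((p - q) / p) * t powr q)"
    by algebra+
  ultimately have "(q / p) * (c * r powr q) \<le> (q / p) * (r powr p + c * ((p - q) / p) * t powr q)"
    by (simp only:)
  moreover have "0 < q / p" using assms by simp
  ultimately have "c * r powr q \<le> r powr p + c * ((p - q) / p) * t powr q"
    by (simp only: mult_le_cancel_left_pos)
  thus ?thesis by (simp add: tq)
qed

lemma cpowr_of_real_exponent:
  fixes s :: complex and p :: real
  assumes "s \<noteq> 0"
  shows "Re (s powr of_real p) = cmod s powr p * cos (p * Im (Ln s))"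
    and "Im (s powr of_real p) = cmod s powr p * sin (p * Im (Ln s))"
  using assms by (simp_all add: powr_def Re_exp Im_exp)

lemma trinomial_zero_angle:
  fixes p q c d :: real and s :: complex
  assumes "0 < q" "q < p" "0 < c" "s \<noteq> 0"
    and zero: "s powr of_real p - of_real c * s powr of_real q - of_real d = 0"
    and angle: "0 < \<bar>Im (Ln s)\<bar>" "p * \<bar>Im (Ln s)\<bar> < pi"
  defines "x \<equiv> \<bar>Im (Ln s)\<bar>"
  shows "- d = c * (sin ((p - q) * x) / sin (p * x)) * (c * (sin (q * x) / sin (p * x))) powr (q / (p - q))"
proof -
  let ?r = "cmod s"
  have r: "0 < ?r" using assms by simp
  have x: "0 < x" "p * x < pi" using angle by (simp_all add: x_def)
  have "q * x < p * x" using assms(2) x by simp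
  with x have "q * x < pi" by linarith
  with x have sp: "0 < sin (p * x)" and sq: "0 < sin (q * x)"
    using assms(1,2) by (auto intro!: sin_gt_zero)
  have "Re (s powr of_real p - of_real c * s powr of_real q - of_real d) = 0"
    "Im (s powr of_real p - of_real c * s powr of_real q - of_real d) = 0"
    by (simp_all only: zero zero_complex.simps)
  hence "?r powr p * cos (p * Im (Ln s)) - c * (?r powr q * cos (q * Im (Ln s))) - d = 0"
    "?r powr p * sin (p * Im (Ln s)) - c * (?r powr q * sin (q * Im (Ln s))) = 0"
    using \<open>s \<noteq> 0\<close> by (simp_all add: cpowr_of_real_exponent)
  \<comment> \<open>Cosine is even and sine is odd, so passing to \<bar>Arg s\<bar> keeps the real
    equation and at most flips the sign of the imaginary one.\<close>
  hence re: "?r powr p * cos (p * x) - c * (?r powr q * cos (q * x)) = d"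
    and im: "?r powr p * sin (p * x) = c * (?r powr q * sin (q * x))"
    by (auto simp: x_def abs_if)
  have rp: "?r powr p = ?r powr (p - q) * ?r powr q" by (simp flip: powr_add)
  have rpq: "?r powr (p - q) = c * (sin (q * x) / sin (p * x))"
    using im r sp unfolding rp by (simp add: field_simps)
  have "(?r powr (p - q)) powr (q / (p - q)) = ?r powr q"
    using assms by (simp add: powr_powr)
  hence rq: "?r powr q = (c * (sin (q * x) / sin (p * x))) powr (q / (p - q))"
    by (simp add: rpq)
  \<comment> \<open>After multiplying the real part by sin(px), the imaginary part replaces r^p
    sin(px) by c r^q sin(qx), which produces the subtraction formula for sin(px - qx).\<close>
  have "- d * sin (p * x) = c * ?r powr q * (sin (p * x) * cos (q * x) - cos (p * x) * sin (q * x))"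
    using im by (simp add: re[symmetric] algebra_simps)
  also have "\<dots> = c * ?r powr q * sin ((p - q) * x)"
    by (simp add: left_diff_distrib sin_diff)
  finally show ?thesis using sp unfolding rq[symmetric] by (simp add: field_simps)
qed

lemma trinomial_zero_bound:
  fixes p q c d :: real and s :: complex
  assumes "0 < q" "q < p" "p < 2" "0 < c" "s \<noteq> 0" "0 \<le> Re s"
    and zero: "s powr of_real p - of_real c * s powr of_real q - of_real d = 0"
  shows "- d \<le> c * rho1 q p * (c * rho1_tilde q p) powr (q / (p - q))"
proof -
  define x where "x = \<bar>Im (Ln s)\<bar>"
  \<comment> \<open>This is where \<open>p < 2\<close> enters: sin(px) stays positive for all x in
    (0, pi/2], the end point included.\<close>
  have px: "p * (pi / 2) < pi" using assms by simp
  have x: "0 \<le> x" "x \<le> pi / 2" using assms Re_Ln_pos_le[of s] by (auto simp: x_def)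
  have rho: "rho1 q p = sin ((p - q) * (pi / 2)) / sin (p * (pi / 2))"
    "rho1_tilde q p = sin (q * (pi / 2)) / sin (p * (pi / 2))"
    by (simp_all add: rho1_def rho1_tilde_def)
  \<comment> \<open>The bound increases in both sine ratios, since \<open>c\<close> and the exponent
    are positive. Each case below then only has to compare the two ratios with their values at
    pi/2.\<close>
  have mono: "c * y * (c * z) powr (q / (p - q)) \<le> c * rho1 q p * (c * rho1_tilde q p) powr (q / (p - q))"
    if "0 \<le> y" "y \<le> rho1 q p" "0 \<le> z" "z \<le> rho1_tilde q p" for y z
    using assms that by (intro mult_mono powr_mono2) auto
  show ?thesis
  \<comment> \<open>On the positive real axis the imaginary part is trivially zero and does not
    determine the modulus, hence the separate argument.\<close>
  proof (cases "x = 0")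
    case True
    have "Re (s powr of_real p - of_real c * s powr of_real q - of_real d) = 0"
      by (simp only: zero zero_complex.simps)
    hence "- d = c * cmod s powr q - cmod s powr p"
      using True \<open>s \<noteq> 0\<close> by (simp add: cpowr_of_real_exponent x_def)
    also have "\<dots> \<le> c * ((p - q) / p) * (c * (q / p)) powr (q / (p - q))"
      using assms by (intro powr_trinomial_lower_bound) auto
    also have "\<dots> \<le> c * rho1 q p * (c * rho1_tilde q p) powr (q / (p - q))"
      using assms px unfolding rho
      by (intro mono[unfolded rho] sin_ratio_ge) auto
    finally show ?thesis .
  next
    case False
    hence x0: "0 < x" using x by simp
    have "p * x \<le> p * (pi / 2)" "q * x < p * x" "(p - q) * x < p * x" using assms x x0 by auto
    hence lt: "p * x < pi" "q * x < pi" "(p - q) * x < pi" using px by linarith+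
    hence pos: "0 < sin (p * x)" "0 < sin (q * x)" "0 < sin ((p - q) * x)"
      using assms x0 by (auto intro!: sin_gt_zero)
    have "- d = c * (sin ((p - q) * x) / sin (p * x)) * (c * (sin (q * x) / sin (p * x))) powr (q / (p - q))"
      using assms x0 lt unfolding x_def by (intro trinomial_zero_angle) auto
    also have "\<dots> \<le> c * rho1 q p * (c * rho1_tilde q p) powr (q / (p - q))"
    proof (rule mono)
      show "sin ((p - q) * x) / sin (p * x) \<le> rho1 q p" "sin (q * x) / sin (p * x) \<le> rho1_tilde q p"
        unfolding rho using assms x x0 px by (auto intro!: sin_ratio_mono simp del: times_divide_eq_right)
    qed (use pos in auto)
    finally show ?thesis .
  qed
qed

theorem lemma11:
  fixes \<alpha> :: "real ^ 3" and A :: "real ^ 3 ^ 3"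
    and \<beta>1 \<beta>2 \<beta>3 \<beta>4 a b c d :: real
  assumes "\<And>i. 0 < \<alpha> $ i \<and> \<alpha> $ i \<le> 1"
    and "\<And>s. char_fun \<alpha> A s =
           s powr complex_of_real \<beta>4
             - complex_of_real a * s powr complex_of_real \<beta>3
             - complex_of_real b * s powr complex_of_real \<beta>2
             - complex_of_real c * s powr complex_of_real \<beta>1
             - complex_of_real d"
    and "0 < \<beta>1" and "\<beta>1 \<le> \<beta>2" and "\<beta>2 \<le> \<beta>3" and "\<beta>3 < \<beta>4"
    and "\<beta>4 = \<alpha> $ 1 + \<alpha> $ 2 + \<alpha> $ 3"
    and "d = det A"
    and "a = 0" and "b = 0" and "c > 0" and "\<beta>4 < 2"
    and "d < - c * rho1 \<beta>1 \<beta>4 * (c * rho1_tilde \<beta>1 \<beta>4) powr (\<beta>1 / (\<beta>4 - \<beta>1))"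
  shows "\<forall>s. char_fun \<alpha> A s = 0 \<longrightarrow> Re s < 0"
proof (intro allI impI, rule ccontr)
  fix s assume Q: "char_fun \<alpha> A s = 0" and "\<not> Re s < 0"
  have \<beta>: "0 < \<beta>1" "\<beta>1 < \<beta>4" using assms by auto
  have arg: "0 < \<beta>4 * pi / 2" "\<beta>4 * pi / 2 < pi" "0 < \<beta>1 * pi / 2" "0 < (\<beta>4 - \<beta>1) * pi / 2"
    "\<beta>1 * pi / 2 < \<beta>4 * pi / 2" "(\<beta>4 - \<beta>1) * pi / 2 < \<beta>4 * pi / 2"
    using \<beta> assms by auto
  hence "0 < sin (\<beta>4 * pi / 2)" "0 < sin (\<beta>1 * pi / 2)" "0 < sin ((\<beta>4 - \<beta>1) * pi / 2)"
    by (auto intro!: sin_gt_zero simp del: zero_less_mult_iff)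
  hence "0 < rho1 \<beta>1 \<beta>4" by (simp add: rho1_def)
  \<comment> \<open>The threshold for \<open>d\<close> is therefore at most 0, so \<open>d\<close>
    is negative. This rules out s = 0, where both powers vanish and the value of the function is
    \<open>- d\<close>.\<close>
  hence "0 \<le> c * rho1 \<beta>1 \<beta>4 * (c * rho1_tilde \<beta>1 \<beta>4) powr (\<beta>1 / (\<beta>4 - \<beta>1))"
    using assms by simp
  hence "d < 0" using assms by simp
  have zero: "s powr of_real \<beta>4 - of_real c * s powr of_real \<beta>1 - of_real d = 0"
    using Q assms(2)[of s] \<open>a = 0\<close> \<open>b = 0\<close> by simp
  with \<open>d < 0\<close> have "s \<noteq> 0" by auto
  with zero \<beta> assms \<open>\<not> Re s < 0\<close>
  have "- d \<le> c * rho1 \<beta>1 \<beta>4 * (c * rho1_tilde \<beta>1 \<beta>4) powr (\<beta>1 / (\<beta>4 - \<beta>1))"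
    by (intro trinomial_zero_bound) auto
  with assms show False by simp
qed

end
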